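(* Let $D\subset\mathbb{R}^2$ be a domain that is discretized by a finite set of cells $\{C_i\}_{i=1,\dots,I}$, where each $C_i$ is a (non-degenerate) triangle and the discretization has no hanging nodes. Let $\Omega\in\mathbb{R}^2$, $\Omega\neq 0$, be a fixed direction. Then sweeping in direction $\Omega$ is possible; that is, there is an ordering of the cells $C_1,\dots,C_I$ in which every cell comes after all cells that it depends on with respect to $\Omega$ (equivalently, the dependency graph $G$ induced by $\Omega$ is acyclic).
   Context: Discretization without hanging nodes: the cells $C_1,\dots,C_I$ are distinct closed non-degenerate triangles in the plane whose union is the (closed) domain, and any two distinct cells $C_i, C_{i'}$ have disjoint interiors and intersect either in the empty set, or in exactly one common vertex, or in exactly one common full edge (so no vertex of one triangle lies in the relative interior of an edge of another triangle). The triangles are otherwise arbitrary; they need not be equilateral or congruent. Dependency: given the direction $\Omega$, cell $C_i$ depends on cell $C_{i'}$ ($i\neq i'$) if and only if $C_i$ and $C_{i'}$ share an edge $e_{i',i}$ and the normal $n_i$ to $e_{i',i}$ that points inward with respect to $C_i$ satisfies $\langle n_i,\Omega\rangle>0$. Dependency graph: $G$ is the directed graph with nodes $1,\dots,I$ and a directed edge from $i'$ to $i$ exactly when $C_i$ depends on $C_{i'}$. Sweeping is possible means that all cells can be visited one after another so that each $C_i$ is visited after all cells it depends on, i.e. $G$ has a topological ordering; this holds if and only if $G$ contains no directed cycle. *)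

theory Defs
  imports "HOL-Analysis.Analysis"
begin

text \<open>
  \<open>D\<close> may be the open domain or its closure; openness and connectedness are not required.
  A non-degenerate closed triangle is a 2-simplex, its edges are its 1-dimensional faces
  and its vertices are its extreme points.
\<close>

definition conforming_triangulation :: "(real^2) set \<Rightarrow> nat \<Rightarrow> (nat \<Rightarrow> (real^2) set) \<Rightarrow> bool" where
  "conforming_triangulation D I C \<longleftrightarrow>
     closure D = (\<Union>i\<in>{1..I}. C i) \<and>
     (\<forall>i\<in>{1..I}. 2 simplex C i) \<and>
     inj_on C {1..I} \<and>
     (\<forall>i\<in>{1..I}. \<forall>j\<in>{1..I}. i \<noteq> j \<longrightarrow>
        interior (C i) \<inter> interior (C j) = {} \<and>
        (C i \<inter> C j = {} \<or>
         (\<exists>v. v extreme_point_of C i \<and> v extreme_point_of C j \<and> C i \<inter> C j = {v}) \<or>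
         (\<exists>e. e edge_of C i \<and> e edge_of C j \<and> C i \<inter> C j = e)))"

definition inward_normal :: "(real^2) set \<Rightarrow> (real^2) set \<Rightarrow> real^2 \<Rightarrow> bool" where
  "inward_normal T e n \<longleftrightarrow>
     norm n = 1 \<and>
     (\<forall>x\<in>e. \<forall>y\<in>e. n \<bullet> (y - x) = 0) \<and>
     (\<forall>x\<in>e. \<forall>y\<in>T. n \<bullet> (y - x) \<ge> 0)"

lemma inward_normal_ex1:
  assumes T: "2 simplex T" and e: "e edge_of T"
  shows "\<exists>!n. inward_normal T e n"
proof (rule ex_ex1I)
  have dim: "aff_dim T = 2"
    using T by (rule aff_dim_simplex)
  have ef: "e face_of T" and de: "aff_dim e = 1"
    using e by (auto simp: edge_of_def)
  have "polyhedron T"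
    using T by (simp add: simplex_imp_polyhedron)
  then have "e exposed_face_of T"
    using ef by (simp add: exposed_face_of_polyhedron)
  then obtain a b where ab: "T \<subseteq> {x. a \<bullet> x \<le> b}" "e = T \<inter> {x. a \<bullet> x = b}"
    by (auto simp: exposed_face_of_def)
  have e_ne: "e \<noteq> {}"
    using de by auto
  have "a \<noteq> 0"
  proof
    assume "a = 0"
    then have "e = T" using ab e_ne by auto
    then show False using dim de by simp
  qed
  then have "inward_normal T e (- (a /\<^sub>R norm a))"
    using ab by (auto simp: inward_normal_def inner_diff_right divide_simps)
  then show "\<exists>n. inward_normal T e n" ..
next
  fix m n
  assume mn: "inward_normal T e m" "inward_normal T e n"
  have dim: "aff_dim T = 2"
    using T by (rule aff_dim_simplex)
  have de: "aff_dim e = 1" "e \<subseteq> T"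
    using e by (auto simp: edge_of_def face_of_imp_subset)
  obtain x where x: "x \<in> e"
    using de by fastforce
  have "e \<noteq> {x}"
    using de by auto
  then obtain y where y: "y \<in> e" "y \<noteq> x"
    using x by auto
  let ?u = "y - x"
  have u: "?u $ 1 \<noteq> 0 \<or> ?u $ 2 \<noteq> 0"
    using y by (simp add: vec_eq_iff forall_2)
  have eqs: "m$1 * ?u$1 + m$2 * ?u$2 = 0" "n$1 * ?u$1 + n$2 * ?u$2 = 0"
    using mn x y by (auto simp: inward_normal_def inner_vec_def sum_2)
  have nrm: "m$1 * m$1 + m$2 * m$2 = 1" "n$1 * n$1 + n$2 * n$2 = 1"
    using mn by (auto simp: inward_normal_def norm_eq_1 inner_vec_def sum_2)
  have "?u$1 * (m$1 * n$2 - m$2 * n$1) = 0" "?u$2 * (m$1 * n$2 - m$2 * n$1) = 0"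
    using eqs by algebra+
  then have cross: "m$1 * n$2 = m$2 * n$1"
    using u by auto
  have dot: "(m$1 * n$1 + m$2 * n$2)\<^sup>2 = 1"
    using nrm cross by algebra
  have "m = (m \<bullet> n) *\<^sub>R n"
    using nrm cross unfolding vec_eq_iff forall_2 inner_vec_def sum_2
    by (simp, algebra)
  moreover have "m \<bullet> n = 1 \<or> m \<bullet> n = -1"
    using dot by (simp add: inner_vec_def sum_2 power2_eq_1_iff)
  ultimately consider "m = n" | "m = - n"
    by (metis scaleR_minus1_left scaleR_one)
  then show "m = n"
  proof cases
    case 2
    have "n \<bullet> z = n \<bullet> x" if "z \<in> T" for z
    proof -
      have "m \<bullet> (z - x) \<ge> 0" "n \<bullet> (z - x) \<ge> 0"
        using mn x that unfolding inward_normal_def by blast+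
      then show ?thesis
        unfolding 2 by (simp add: inner_diff_right)
    qed
    then have "T \<subseteq> {z. n \<bullet> z = n \<bullet> x}" by auto
    then have "aff_dim T \<le> aff_dim {z. n \<bullet> z = n \<bullet> x}"
      by (rule aff_dim_subset)
    moreover have "n \<noteq> 0"
      using mn by (auto simp: inward_normal_def)
    ultimately show ?thesis
      using dim by simp
  qed
qed

definition depends_on :: "real^2 \<Rightarrow> (nat \<Rightarrow> (real^2) set) \<Rightarrow> nat \<Rightarrow> nat \<Rightarrow> bool" where
  "depends_on \<Omega> C i i' \<longleftrightarrow>
     i \<noteq> i' \<and>
     (\<exists>e n. e edge_of C i \<and> e edge_of C i' \<and> inward_normal (C i) e n \<and> n \<bullet> \<Omega> > 0)"

text \<open>The pair \<open>(i', i)\<close> is the directed edge from \<open>i'\<close> to \<open>i\<close>.\<close>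

definition dependency_graph :: "real^2 \<Rightarrow> nat \<Rightarrow> (nat \<Rightarrow> (real^2) set) \<Rightarrow> (nat \<times> nat) set" where
  "dependency_graph \<Omega> I C = {(i', i). i' \<in> {1..I} \<and> i \<in> {1..I} \<and> depends_on \<Omega> C i i'}"

definition sweeping_possible :: "real^2 \<Rightarrow> nat \<Rightarrow> (nat \<Rightarrow> (real^2) set) \<Rightarrow> bool" where
  "sweeping_possible \<Omega> I C \<longleftrightarrow>
     (\<exists>\<sigma>. distinct \<sigma> \<and> set \<sigma> = {1..I} \<and>
        (\<forall>p<length \<sigma>. \<forall>q<length \<sigma>. depends_on \<Omega> C (\<sigma> ! p) (\<sigma> ! q) \<longrightarrow> q < p))"

end

theory Submission
  imports Defs
begin

text \<open>
  If a cell depends on a neighbour, then some ray in direction \<open>\<Omega>\<close> passes from the interior of the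
  neighbour into the interior of the cell (\<open>precedes_interior_across_edge\<close>). It is therefore enough
  that, in the plane, the relation ``some ray in direction \<open>\<Omega>\<close> leads from \<open>U\<close> to \<open>V\<close>'' has no cycle
  on a finite family of pairwise disjoint bounded open convex sets (\<open>acyclic_precedes_plane\<close>).

  Two disjoint convex sets cannot precede each other (\<open>precedes_asym\<close>). The relation is not
  transitive in general, since \<open>x\<close> before \<open>m\<close> and \<open>m\<close> before \<open>y\<close> may be witnessed by different lines.
  Project along \<open>\<Omega>\<close>: the plane becomes a line and the shadow of each set an interval. Let \<open>m\<close> be the set
  whose shadow has the least right end. If \<open>x\<close> precedes \<open>m\<close> and \<open>m\<close> precedes \<open>y\<close>, then the shadows of
  \<open>x\<close> and \<open>y\<close> both meet that of \<open>m\<close> and reach at least as far to the right, so the line in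
  direction \<open>\<Omega>\<close> through the rightmost of these two contacts meets all three sets. On this line the order is
  visible and \<open>x\<close> precedes \<open>y\<close> (\<open>precedes_trans_via_least_Sup\<close>). Hence every path can bypass \<open>m\<close>, a cycle
  would yield a cycle among the remaining sets (\<open>acyclic_bypass\<close>), and induction on the number of
  sets concludes.
\<close>

section \<open>Reachability along a direction\<close>

definition precedes :: "'a::real_vector \<Rightarrow> 'a set \<Rightarrow> 'a set \<Rightarrow> bool" where
  "precedes \<Omega> U V \<longleftrightarrow> (\<exists>x\<in>U. \<exists>t>0. x + t *\<^sub>R \<Omega> \<in> V)"

text \<open>
  Slide a point of \<open>U\<close> from \<open>x\<close> to \<open>y + s \<Omega>\<close> while a point of \<open>V\<close> slides from \<open>x + t \<Omega>\<close> to \<open>y\<close>. Their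
  difference is a multiple of \<open>\<Omega>\<close> that goes affinely from \<open>t > 0\<close> to \<open>- s < 0\<close>, so the points meet.
\<close>

lemma precedes_asym:
  assumes "convex U" "convex V" "U \<inter> V = {}" "precedes \<Omega> U V"
  shows "\<not> precedes \<Omega> V U"
proof
  assume "precedes \<Omega> V U"
  then obtain y s where y: "y \<in> V" "s > 0" "y + s *\<^sub>R \<Omega> \<in> U"
    by (auto simp: precedes_def)
  obtain x t where x: "x \<in> U" "t > 0" "x + t *\<^sub>R \<Omega> \<in> V"
    using assms(4) by (auto simp: precedes_def)
  \<comment> \<open>the parameter at which the coefficient \<open>(1 - l) t - l s\<close> of \<open>\<Omega>\<close> vanishes\<close>
  define l where "l = t / (t + s)"
  have l: "0 \<le> l" "l \<le> 1" "(1 - l) * t = l * s"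
    using x y by (auto simp: l_def field_simps)
  have "(1 - l) *\<^sub>R x + l *\<^sub>R (y + s *\<^sub>R \<Omega>) \<in> U"
    using assms(1) x y l by (intro convexD) auto
  moreover have "(1 - l) *\<^sub>R (x + t *\<^sub>R \<Omega>) + l *\<^sub>R y \<in> V"
    using assms(2) x y l by (intro convexD) auto
  moreover have "(1 - l) *\<^sub>R (x + t *\<^sub>R \<Omega>) + l *\<^sub>R y
      = (1 - l) *\<^sub>R x + l *\<^sub>R (y + s *\<^sub>R \<Omega>)"
    using l(3) by (simp add: scaleR_add_right)
  ultimately show False
    using assms(3) by auto
qed

section \<open>Convex sets in the plane\<close>

lemma orthogonal_imp_parallel_plane:
  fixes n u v :: "real^2"
  assumes "n \<noteq> 0" "u \<noteq> 0" "n \<bullet> u = 0" "n \<bullet> v = 0"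
  obtains c where "v = c *\<^sub>R u"
proof -
  have n: "n$1 \<noteq> 0 \<or> n$2 \<noteq> 0"
    using assms(1) by (simp add: vec_eq_iff forall_2)
  have eqs: "n$1 * u$1 + n$2 * u$2 = 0" "n$1 * v$1 + n$2 * v$2 = 0"
    using assms(3,4) by (auto simp: inner_vec_def sum_2)
  have "n$1 * (u$1 * v$2 - u$2 * v$1) = 0" "n$2 * (u$1 * v$2 - u$2 * v$1) = 0"
    using eqs by algebra+
  then have cross: "u$1 * v$2 = u$2 * v$1"
    using n by auto
  have "u \<bullet> u \<noteq> 0"
    using assms(2) by simp
  moreover have "(u \<bullet> u) *\<^sub>R v = (u \<bullet> v) *\<^sub>R u"
    using cross unfolding vec_eq_iff forall_2 inner_vec_def sum_2
    by (simp, algebra)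
  ultimately have "v = ((u \<bullet> v) / (u \<bullet> u)) *\<^sub>R u"
    by (metis scaleR_scaleR divide_inverse_commute scaleR_one left_inverse)
  then show thesis
    by (rule that)
qed

text \<open>
  Once \<open>U\<close> precedes \<open>V\<close> along one line, asymmetry forces the same order on every line in direction
  \<open>\<Omega>\<close> that meets both. The vector \<open>w\<close> serves as coordinate transverse to \<open>\<Omega>\<close>; being in the plane
  ensures that points with equal \<open>w\<close>-coordinate lie on a common such line.
\<close>

lemma precedes_same_shadow:
  fixes \<Omega> w :: "real^2"
  assumes w: "w \<noteq> 0" "w \<bullet> \<Omega> = 0" and "\<Omega> \<noteq> 0"
    and UV: "convex U" "convex V" "U \<inter> V = {}" "precedes \<Omega> U V"
    and pq: "p \<in> U" "q \<in> V" "w \<bullet> p = w \<bullet> q"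
  obtains r where "r > 0" "q = p + r *\<^sub>R \<Omega>"
proof -
  have "w \<bullet> (q - p) = 0"
    using pq by (simp add: inner_diff_right)
  then obtain r where r: "q - p = r *\<^sub>R \<Omega>"
    using orthogonal_imp_parallel_plane w \<open>\<Omega> \<noteq> 0\<close> by metis
  then have q: "q = p + r *\<^sub>R \<Omega>"
    by (simp add: algebra_simps)
  have "r \<noteq> 0"
    using q pq UV(3) by auto
  moreover have "\<not> r < 0"
  proof
    assume "r < 0"
    moreover have "p = q + (- r) *\<^sub>R \<Omega>"
      using q by simp
    ultimately have "precedes \<Omega> V U"
      unfolding precedes_def using pq by (metis neg_0_less_iff_less)
    then show False
      using precedes_asym UV by blast
  qed
  ultimately have "r > 0"
    by linarith
  then show thesis
    using q by (rule that)
qed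

text \<open>
  The shadow of a set is its image under \<open>(\<bullet>) w\<close>. As \<open>M\<close> is open, its shadow does not attain its
  supremum, so the shadow of \<open>U\<close> has points strictly beyond \<open>s\<close>, and, being an interval, contains
  everything from \<open>s'\<close> up to them.
\<close>

lemma shadow_extends_right:
  fixes w :: "'a::real_inner"
  assumes "w \<noteq> 0" "convex U" "open M" "bounded M"
    and Sup_le: "Sup ((\<bullet>) w ` M) \<le> Sup ((\<bullet>) w ` U)"
    and s: "s \<in> (\<bullet>) w ` M" and s': "s' \<in> (\<bullet>) w ` U" "s' \<le> s"
  shows "s \<in> (\<bullet>) w ` U"
proof -
  obtain x where x: "x \<in> M" "s = w \<bullet> x"
    using s by auto
  obtain d where d: "d > 0" "\<And>y. dist y x < d \<Longrightarrow> y \<in> M"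
    using \<open>open M\<close> x(1) by (auto simp: open_dist)
  define y where "y = x + (d / (2 * norm w)) *\<^sub>R w"
  have "y \<in> M"
    using d \<open>w \<noteq> 0\<close> by (auto simp: y_def dist_norm)
  moreover have "s < w \<bullet> y"
    using d \<open>w \<noteq> 0\<close> by (simp add: y_def x(2) inner_add_right)
  moreover have "bdd_above ((\<bullet>) w ` M)"
    using \<open>bounded M\<close> by (intro bounded_imp_bdd_above bounded_linear_image bounded_linear_inner_right)
  ultimately have "s < Sup ((\<bullet>) w ` M)"
    by (meson cSup_upper image_eqI less_le_trans)
  then have "s < Sup ((\<bullet>) w ` U)"
    using Sup_le by simp
  then obtain s'' where s'': "s'' \<in> (\<bullet>) w ` U" "s < s''"
    using s'(1) less_cSupE by blast
  have "convex ((\<bullet>) w ` U)"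
    using \<open>convex U\<close> by (intro convex_linear_image bounded_linear.linear bounded_linear_inner_right)
  then have "is_interval ((\<bullet>) w ` U)"
    by (simp add: is_interval_convex_1)
  then show ?thesis
    using s'(1) s'(2) s'' unfolding is_interval_1 by (meson less_imp_le)
qed

lemma precedes_trans_via_least_Sup:
  fixes \<Omega> w :: "real^2"
  assumes w: "w \<noteq> 0" "w \<bullet> \<Omega> = 0" and "\<Omega> \<noteq> 0"
    and convex: "convex U" "convex M" "convex V" and M: "open M" "bounded M"
    and disjoint: "U \<inter> M = {}" "M \<inter> V = {}"
    and least: "Sup ((\<bullet>) w ` M) \<le> Sup ((\<bullet>) w ` U)" "Sup ((\<bullet>) w ` M) \<le> Sup ((\<bullet>) w ` V)"
    and prec: "precedes \<Omega> U M" "precedes \<Omega> M V"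
  shows "precedes \<Omega> U V"
proof -
  obtain x t where x: "x \<in> U" "x + t *\<^sub>R \<Omega> \<in> M"
    using prec(1) by (auto simp: precedes_def)
  obtain y r where y: "y \<in> M" "y + r *\<^sub>R \<Omega> \<in> V"
    using prec(2) by (auto simp: precedes_def)
  have sx: "w \<bullet> x \<in> (\<bullet>) w ` U" "w \<bullet> x \<in> (\<bullet>) w ` M"
    using x w(2) by (auto simp: inner_add_right intro!: image_eqI[where x = "x + t *\<^sub>R \<Omega>"])
  have sy: "w \<bullet> y \<in> (\<bullet>) w ` M" "w \<bullet> y \<in> (\<bullet>) w ` V"
    using y w(2) by (auto simp: inner_add_right intro!: image_eqI[where x = "y + r *\<^sub>R \<Omega>"])
  \<comment> \<open>the rightmost of the two contacts lies in all three shadows\<close>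
  define s where "s = max (w \<bullet> x) (w \<bullet> y)"
  have sM: "s \<in> (\<bullet>) w ` M"
    using sx(2) sy(1) by (simp only: s_def max_def split: if_split) blast
  have "s \<in> (\<bullet>) w ` U"
    using shadow_extends_right[OF w(1) convex(1) M least(1) sM sx(1)] by (simp add: s_def)
  then obtain p where p: "p \<in> U" "w \<bullet> p = s"
    by auto
  have "s \<in> (\<bullet>) w ` V"
    using shadow_extends_right[OF w(1) convex(3) M least(2) sM sy(2)] by (simp add: s_def)
  then obtain q where q: "q \<in> V" "w \<bullet> q = s"
    by auto
  obtain m where m: "m \<in> M" "w \<bullet> m = s"
    using sM by auto
  obtain a where a: "a > 0" "m = p + a *\<^sub>R \<Omega>"
    using precedes_same_shadow[OF w \<open>\<Omega> \<noteq> 0\<close> convex(1,2) disjoint(1) prec(1) p(1) m(1)] p m by auto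
  obtain b where b: "b > 0" "q = m + b *\<^sub>R \<Omega>"
    using precedes_same_shadow[OF w \<open>\<Omega> \<noteq> 0\<close> convex(2,3) disjoint(2) prec(2) m(1) q(1)] q m by auto
  have "q = p + (a + b) *\<^sub>R \<Omega>" "a + b > 0"
    using a b by (simp_all add: scaleR_add_left)
  then show ?thesis
    unfolding precedes_def using p(1) q(1) by metis
qed

section \<open>Acyclicity by bypassing a node\<close>

text \<open>
  A path between nodes other than \<open>m\<close> can replace each detour through \<open>m\<close> by a direct edge, so a
  cycle survives the removal of \<open>m\<close>.
\<close>

lemma acyclic_bypass:
  assumes acyc: "acyclic (R \<inter> (- {m}) \<times> (- {m}))"
    and irrefl: "(m, m) \<notin> R"
    and bypass: "\<And>x y. (x, m) \<in> R \<Longrightarrow> (m, y) \<in> R \<Longrightarrow> (x, y) \<in> R"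
  shows "acyclic R"
proof -
  define S where "S = R \<inter> (- {m}) \<times> (- {m})"
  \<comment> \<open>the case \<open>y = m\<close> keeps the last edge aside, so that it can be merged with the next one\<close>
  have path: "if y = m then \<exists>z. (x, z) \<in> S\<^sup>* \<and> (z, m) \<in> R else (x, y) \<in> S\<^sup>+"
    if "(x, y) \<in> R\<^sup>+" "x \<noteq> m" for x y
    using that
  proof (induction rule: trancl_induct)
    case (base y)
    then have "(x, y) \<in> S" if "y \<noteq> m"
      using that by (simp add: S_def)
    then show ?case
      using base by (metis r_into_trancl rtrancl.rtrancl_refl)
  next
    case (step y z)
    show ?case
    proof (cases "y = m")
      case True
      then obtain v where v: "(x, v) \<in> S\<^sup>*" "(v, m) \<in> R"
        using step by auto
      have "z \<noteq> m" "v \<noteq> m"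
        using True step.hyps irrefl v by auto
      moreover have "(v, z) \<in> R"
        using bypass v step.hyps True by auto
      ultimately have "(v, z) \<in> S"
        by (simp add: S_def)
      then show ?thesis
        using rtrancl_into_trancl1[OF v(1)] \<open>z \<noteq> m\<close> by simp
    next
      case False
      then have xy: "(x, y) \<in> S\<^sup>+"
        using step by simp
      show ?thesis
      proof (cases "z = m")
        case True
        then show ?thesis
          using trancl_into_rtrancl[OF xy] step.hyps by auto
      next
        case z: False
        then have "(y, z) \<in> S"
          using False step.hyps by (simp add: S_def)
        then show ?thesis
          using trancl_into_trancl[OF xy] z by simp
      qed
    qed
  qed
  have no_cycle: "(x, x) \<notin> R\<^sup>+" if "x \<noteq> m" for x
    using path[of x x] that acyc unfolding S_def[symmetric] acyclic_def by metis
  \<comment> \<open>a cycle through \<open>m\<close> also passes through the successor of \<open>m\<close>\<close>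
  have "(m, m) \<notin> R\<^sup>+"
  proof
    assume "(m, m) \<in> R\<^sup>+"
    then obtain y where y: "(m, y) \<in> R" "(y, m) \<in> R\<^sup>*"
      by (meson tranclD)
    then have "y \<noteq> m"
      using irrefl by auto
    moreover have "(y, y) \<in> R\<^sup>+"
      using rtrancl_into_trancl1[OF y(2,1)] .
    ultimately show False
      using no_cycle by blast
  qed
  then show ?thesis
    unfolding acyclic_def using no_cycle by metis
qed

theorem acyclic_precedes_plane:
  fixes U :: "'i \<Rightarrow> (real^2) set" and \<Omega> :: "real^2"
  assumes "finite A" "\<Omega> \<noteq> 0"
    and U: "\<And>i. i \<in> A \<Longrightarrow> convex (U i)" "\<And>i. i \<in> A \<Longrightarrow> open (U i)" "\<And>i. i \<in> A \<Longrightarrow> bounded (U i)"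
    and disjoint: "\<And>i j. i \<in> A \<Longrightarrow> j \<in> A \<Longrightarrow> i \<noteq> j \<Longrightarrow> U i \<inter> U j = {}"
  shows "acyclic {(j, i). j \<in> A \<and> i \<in> A \<and> j \<noteq> i \<and> precedes \<Omega> (U j) (U i)}"
proof -
  \<comment> \<open>\<open>\<Omega>\<close> rotated by a right angle\<close>
  define w :: "real^2" where "w = vector [- (\<Omega> $ 2), \<Omega> $ 1]"
  have w: "w \<noteq> 0" "w \<bullet> \<Omega> = 0"
    using \<open>\<Omega> \<noteq> 0\<close> by (auto simp: w_def vec_eq_iff forall_2 inner_vec_def sum_2)
  show ?thesis
    using \<open>finite A\<close> U disjoint
  proof (induction A rule: finite_psubset_induct)
    case (psubset A)
    let ?R = "\<lambda>A. {(j, i). j \<in> A \<and> i \<in> A \<and> j \<noteq> i \<and> precedes \<Omega> (U j) (U i)}"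
    show ?case
    proof (cases "A = {}")
      case True
      then show ?thesis by (simp add: acyclic_def)
    next
      case False
      define f where "f i = Sup ((\<bullet>) w ` U i)" for i
      have "Min (f ` A) \<in> f ` A"
        using False psubset.hyps by (intro Min_in) auto
      then obtain m where m: "m \<in> A" "f m = Min (f ` A)"
        by auto
      have least: "f m \<le> f i" if "i \<in> A" for i
        using m psubset.hyps that by simp
      have "acyclic (?R (A - {m}))"
        using psubset.prems m by (intro psubset.IH) auto
      moreover have "?R A \<inter> (- {m}) \<times> (- {m}) = ?R (A - {m})"
        by auto
      ultimately have "acyclic (?R A \<inter> (- {m}) \<times> (- {m}))"
        by simp
      then show ?thesis
      proof (rule acyclic_bypass)
        fix x y
        assume "(x, m) \<in> ?R A" "(m, y) \<in> ?R A"
        then have xy: "x \<in> A" "y \<in> A" "x \<noteq> m" "m \<noteq> y"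
          and prec: "precedes \<Omega> (U x) (U m)" "precedes \<Omega> (U m) (U y)"
          by auto
        \<comment> \<open>the graph omits loops because a nonempty open set precedes itself\<close>
        have "x \<noteq> y"
          using precedes_asym[of "U x" "U m" \<Omega>] psubset.prems xy prec m by auto
        moreover have "precedes \<Omega> (U x) (U y)"
          using precedes_trans_via_least_Sup[OF w \<open>\<Omega> \<noteq> 0\<close> _ _ _ _ _ _ _ _ _ prec]
            psubset.prems xy m(1) least[unfolded f_def] by simp
        ultimately show "(x, y) \<in> ?R A"
          using xy by simp
      qed simp
    qed
  qed
qed

section \<open>Cells sharing an edge\<close>

text \<open>
  Write \<open>d = \<beta> (a - m) + \<alpha> (q - p)\<close> with \<open>m\<close> the midpoint and \<open>\<beta> > 0\<close>. Then \<open>m + \<epsilon> d\<close> lies on the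
  segment from \<open>a\<close> to a point of the line through \<open>p\<close> and \<open>q\<close>, and for small \<open>\<epsilon>\<close> that point is so
  close to \<open>m\<close> that it still lies between \<open>p\<close> and \<open>q\<close>.
\<close>

lemma midpoint_into_interior:
  fixes T :: "(real^2) set"
  assumes T: "convex T" "p \<in> T" "q \<in> T" and "p \<noteq> q" and n: "n \<bullet> (q - p) = 0"
    and a: "a \<in> interior T" "n \<bullet> (a - p) > 0" and d: "n \<bullet> d > 0"
  shows "\<forall>\<^sub>F \<epsilon> in at_right 0. midpoint p q + \<epsilon> *\<^sub>R d \<in> interior T"
proof -
  define m where "m = midpoint p q"
  have "n \<bullet> q = n \<bullet> p"
    using n by (simp add: inner_diff_right)
  then have nm: "n \<bullet> m = n \<bullet> p"
    unfolding m_def midpoint_def inner_scaleR_right inner_add_right by simp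
  then have am: "n \<bullet> (a - m) > 0"
    using a by (simp add: inner_diff_right)
  define \<beta> where "\<beta> = n \<bullet> d / (n \<bullet> (a - m))"
  have \<beta>: "\<beta> > 0"
    using am d by (simp add: \<beta>_def)
  have "n \<bullet> (d - \<beta> *\<^sub>R (a - m)) = 0"
    using am by (simp add: inner_diff_right[of n d] \<beta>_def)
  moreover have "n \<noteq> 0" "q - p \<noteq> 0"
    using d \<open>p \<noteq> q\<close> by auto
  ultimately obtain \<alpha> where \<alpha>: "d - \<beta> *\<^sub>R (a - m) = \<alpha> *\<^sub>R (q - p)"
    using orthogonal_imp_parallel_plane n by metis
  \<comment> \<open>\<open>m + c \<epsilon> (q - p)\<close> is where the line from \<open>a\<close> through \<open>m + \<epsilon> d\<close> meets the line \<open>pq\<close>\<close>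
  define c where "c \<epsilon> = \<epsilon> * \<alpha> / (1 - \<epsilon> * \<beta>)" for \<epsilon>
  have "((\<lambda>\<epsilon>. \<epsilon> * \<beta>) \<longlongrightarrow> 0 * \<beta>) (at_right 0)"
    by (intro tendsto_intros)
  then have "\<forall>\<^sub>F \<epsilon> in at_right 0. \<epsilon> * \<beta> < 1"
    by (rule order_tendstoD) simp
  moreover have "(c \<longlongrightarrow> 0 * \<alpha> / (1 - 0 * \<beta>)) (at_right 0)"
    unfolding c_def by (intro tendsto_intros) simp
  then have c: "(c \<longlongrightarrow> 0) (at_right 0)"
    by simp
  have "\<forall>\<^sub>F \<epsilon> in at_right 0. c \<epsilon> < 1 / 2" "\<forall>\<^sub>F \<epsilon> in at_right 0. - 1 / 2 < c \<epsilon>"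
    using order_tendstoD(2)[OF c, of "1 / 2"] order_tendstoD(1)[OF c, of "- 1 / 2"] by simp_all
  moreover have "\<forall>\<^sub>F \<epsilon> in at_right (0::real). \<epsilon> > 0"
    by (simp add: eventually_at_right_less)
  ultimately show ?thesis
  proof eventually_elim
    case (elim \<epsilon>)
    define y where "y = m + c \<epsilon> *\<^sub>R (q - p)"
    have "y = (1 / 2 - c \<epsilon>) *\<^sub>R p + (1 / 2 + c \<epsilon>) *\<^sub>R q"
      by (simp add: y_def m_def midpoint_def algebra_simps)
    then have "y \<in> T"
      using elim T by (simp only:) (intro convexD, auto)
    then have "y - (\<epsilon> * \<beta>) *\<^sub>R (y - a) \<in> interior T"
      using elim \<beta> T a by (intro mem_interior_convex_shrink) auto
    moreover have "(1 - \<epsilon> * \<beta>) * c \<epsilon> = \<epsilon> * \<alpha>"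
      using elim by (simp add: c_def)
    then have "y - (\<epsilon> * \<beta>) *\<^sub>R (y - a) = m + \<epsilon> *\<^sub>R d"
    proof -
      have "y - (\<epsilon> * \<beta>) *\<^sub>R (y - a)
          = m + ((1 - \<epsilon> * \<beta>) * c \<epsilon>) *\<^sub>R (q - p) + (\<epsilon> * \<beta>) *\<^sub>R (a - m)"
        by (simp add: y_def algebra_simps)
      also have "\<dots> = m + \<epsilon> *\<^sub>R (\<alpha> *\<^sub>R (q - p) + \<beta> *\<^sub>R (a - m))"
        using \<open>(1 - \<epsilon> * \<beta>) * c \<epsilon> = \<epsilon> * \<alpha>\<close> by (simp add: scaleR_add_right)
      also have "\<dots> = m + \<epsilon> *\<^sub>R d"
        using \<alpha> by (metis diff_add_cancel)
      finally show ?thesis .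
    qed
    ultimately show ?case
      by (simp add: m_def)
  qed
qed

lemma open_shift:
  fixes n :: "'a::real_normed_vector"
  assumes "open S" "b \<in> S"
  obtains \<delta> where "\<delta> > 0" "b + \<delta> *\<^sub>R n \<in> S"
proof -
  have "((\<lambda>\<delta>. b + \<delta> *\<^sub>R n) \<longlongrightarrow> b + 0 *\<^sub>R n) (at_right 0)"
    by (intro tendsto_intros)
  then have "\<forall>\<^sub>F \<delta> in at_right 0. b + \<delta> *\<^sub>R n \<in> S"
    using assms by (intro topological_tendstoD) auto
  moreover have "\<forall>\<^sub>F \<delta> in at_right (0::real). \<delta> > 0"
    by (simp add: eventually_at_right_less)
  ultimately have "\<forall>\<^sub>F \<delta> in at_right 0. \<delta> > 0 \<and> b + \<delta> *\<^sub>R n \<in> S"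
    by eventually_elim simp
  then obtain \<delta> :: real where "\<delta> > 0" "b + \<delta> *\<^sub>R n \<in> S"
    by (metis (mono_tags, lifting) eventually_happens trivial_limit_at_right_real)
  then show thesis
    by (rule that)
qed

text \<open>
  Both sets contain the edge, so if \<open>T'\<close> had an interior point on the same side of the edge as \<open>T\<close>, the
  points just off the midpoint of the edge in direction \<open>\<Omega>\<close> would be interior to both. Hence \<open>T'\<close> lies
  on the other side, and the line in direction \<open>\<Omega>\<close> through the midpoint crosses from \<open>T'\<close> to \<open>T\<close>.
\<close>

lemma precedes_interior_across_edge:
  fixes T T' :: "(real^2) set"
  assumes T: "convex T" "interior T \<noteq> {}" and T': "convex T'" "interior T' \<noteq> {}"
    and disjoint: "interior T \<inter> interior T' = {}"
    and e: "e edge_of T" "e edge_of T'"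
    and n: "inward_normal T e n" "n \<bullet> \<Omega> > 0"
  shows "precedes \<Omega> (interior T') (interior T)"
proof -
  have de: "aff_dim e = 1" "e \<subseteq> T" "e \<subseteq> T'"
    using e by (auto simp: edge_of_def face_of_imp_subset)
  obtain p where p: "p \<in> e"
    using de by fastforce
  have "e \<noteq> {p}"
    using de by auto
  then obtain q where q: "q \<in> e" "p \<noteq> q"
    using p by auto
  have npq: "n \<bullet> (q - p) = 0" and inward: "\<And>x. x \<in> T \<Longrightarrow> n \<bullet> (x - p) \<ge> 0"
    using n p q by (auto simp: inward_normal_def)
  have n0: "n \<bullet> n > 0"
    using n(1) by (auto simp: inward_normal_def)
  have pq: "p \<in> T" "q \<in> T" "p \<in> T'" "q \<in> T'"
    using p q de by auto
  \<comment> \<open>the inequality in \<open>inward\<close> is weak, so an interior point is pushed along \<open>n\<close> to make it strict\<close>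
  obtain a0 where a0: "a0 \<in> interior T"
    using T by auto
  obtain \<delta> where \<delta>: "\<delta> > 0" "a0 + \<delta> *\<^sub>R n \<in> interior T"
    using open_shift[OF open_interior a0] .
  have "n \<bullet> (a0 + \<delta> *\<^sub>R n - p) = n \<bullet> (a0 - p) + \<delta> * (n \<bullet> n)"
    by (simp add: algebra_simps)
  moreover have "n \<bullet> (a0 - p) \<ge> 0"
    using inward a0 interior_subset by blast
  ultimately have "n \<bullet> (a0 + \<delta> *\<^sub>R n - p) > 0"
    using \<delta> n0 by (smt (verit) mult_pos_pos)
  then have ev: "\<forall>\<^sub>F \<epsilon> in at_right 0. midpoint p q + \<epsilon> *\<^sub>R \<Omega> \<in> interior T"
    using midpoint_into_interior[OF T(1) pq(1,2) q(2) npq \<delta>(2)] n(2) by blast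
  have not_same_side: "\<not> n \<bullet> (b - p) > 0" if "b \<in> interior T'" for b
  proof
    assume "n \<bullet> (b - p) > 0"
    then have "\<forall>\<^sub>F \<epsilon> in at_right 0. midpoint p q + \<epsilon> *\<^sub>R \<Omega> \<in> interior T'"
      using midpoint_into_interior[OF T'(1) pq(3,4) q(2) npq that] n(2) by blast
    with ev have "\<forall>\<^sub>F \<epsilon> in at_right (0::real). False"
      by eventually_elim (use disjoint in blast)
    then show False
      by (simp add: eventually_False)
  qed
  \<comment> \<open>pushing \<open>b\<close> along \<open>n\<close> rules out that \<open>b\<close> lies on the line through the edge\<close>
  obtain b where b: "b \<in> interior T'"
    using T' by auto
  obtain \<delta>' where \<delta>': "\<delta>' > 0" "b + \<delta>' *\<^sub>R n \<in> interior T'"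
    using open_shift[OF open_interior b] .
  have "n \<bullet> (b + \<delta>' *\<^sub>R n - p) = n \<bullet> (b - p) + \<delta>' * (n \<bullet> n)"
    by (simp add: algebra_simps)
  then have "(- n) \<bullet> (b - p) > 0"
    using not_same_side[OF \<delta>'(2)] \<delta>' n0 by (smt (verit) mult_pos_pos inner_minus_left)
  moreover have "(- n) \<bullet> (q - p) = 0" "(- n) \<bullet> (- \<Omega>) > 0"
    using npq n(2) by auto
  ultimately have "\<forall>\<^sub>F \<epsilon> in at_right 0. midpoint p q + \<epsilon> *\<^sub>R (- \<Omega>) \<in> interior T'"
    using midpoint_into_interior[OF T'(1) pq(3,4) q(2) _ b] by blast
  moreover have "\<forall>\<^sub>F \<epsilon> in at_right (0::real). \<epsilon> > 0"
    by (simp add: eventually_at_right_less)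
  ultimately have "\<forall>\<^sub>F \<epsilon> in at_right 0. \<epsilon> > 0 \<and> midpoint p q + \<epsilon> *\<^sub>R (- \<Omega>) \<in> interior T'
      \<and> midpoint p q + \<epsilon> *\<^sub>R \<Omega> \<in> interior T"
    using ev by eventually_elim simp
  then obtain \<epsilon> :: real where \<epsilon>: "\<epsilon> > 0" "midpoint p q + \<epsilon> *\<^sub>R (- \<Omega>) \<in> interior T'"
      "midpoint p q + \<epsilon> *\<^sub>R \<Omega> \<in> interior T"
    by (metis (mono_tags, lifting) eventually_happens trivial_limit_at_right_real)
  have "midpoint p q + \<epsilon> *\<^sub>R (- \<Omega>) + (2 * \<epsilon>) *\<^sub>R \<Omega> = midpoint p q + \<epsilon> *\<^sub>R \<Omega>"
    by (simp add: scaleR_2 flip: scaleR_scaleR)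
  then show ?thesis
    unfolding precedes_def using \<epsilon> by (metis mult_pos_pos zero_less_numeral)
qed

lemma interior_triangle_nonempty:
  fixes T :: "(real^2) set"
  assumes "2 simplex T"
  shows "interior T \<noteq> {}"
proof -
  have "aff_dim T = int DIM(real^2)"
    using aff_dim_simplex[OF assms] by simp
  then have "rel_interior T = interior T"
    by (intro rel_interior_interior) (simp only: aff_dim_eq_full)
  moreover have "T \<noteq> {}"
    using aff_dim_simplex[OF assms] by auto
  ultimately show ?thesis
    using convex_simplex[OF assms] rel_interior_eq_empty by metis
qed

section \<open>Sweeping orders\<close>

text \<open>The number of ancestors strictly increases along the edges, so sorting by it gives the order.\<close>

lemma acyclic_imp_topological_order:
  assumes "finite A" "acyclic R" "R \<subseteq> A \<times> A"
  obtains xs where "distinct xs" "set xs = A"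
    "\<And>p q. p < length xs \<Longrightarrow> q < length xs \<Longrightarrow> (xs ! q, xs ! p) \<in> R \<Longrightarrow> q < p"
proof -
  define f where "f x = card {y. (y, x) \<in> R\<^sup>+}" for x
  have less: "f y < f x" if "(y, x) \<in> R" for x y
    unfolding f_def
  proof (rule psubset_card_mono)
    have "{z. (z, x) \<in> R\<^sup>+} \<subseteq> A"
      using trancl_subset_Sigma[OF assms(3)] by auto
    then show "finite {z. (z, x) \<in> R\<^sup>+}"
      using assms(1) finite_subset by blast
    have "(y, y) \<notin> R\<^sup>+"
      using assms(2) by (simp add: acyclic_def)
    moreover have "(y, x) \<in> R\<^sup>+"
      using that by blast
    moreover have "{z. (z, y) \<in> R\<^sup>+} \<subseteq> {z. (z, x) \<in> R\<^sup>+}"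
      using trancl_into_trancl[OF _ that] by blast
    ultimately show "{z. (z, y) \<in> R\<^sup>+} \<subset> {z. (z, x) \<in> R\<^sup>+}"
      by blast
  qed
  obtain ys where ys: "set ys = A" "distinct ys"
    using finite_distinct_list[OF assms(1)] by blast
  define xs where "xs = sort_key f ys"
  show thesis
  proof (rule that)
    show "distinct xs" "set xs = A"
      using ys by (auto simp: xs_def)
    fix p q
    assume pq: "p < length xs" "q < length xs" "(xs ! q, xs ! p) \<in> R"
    show "q < p"
    proof (rule ccontr)
      assume "\<not> q < p"
      then have "map f xs ! p \<le> map f xs ! q"
        using pq by (intro sorted_nth_mono) (auto simp: xs_def)
      then show False
        using less[OF pq(3)] pq by simp
    qed
  qed
qed

theorem theorem1:
  fixes D :: "(real^2) set" and I :: nat and C :: "nat \<Rightarrow> (real^2) set" and \<Omega> :: "real^2"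
  assumes "conforming_triangulation D I C"
    and "\<Omega> \<noteq> 0"
  shows "sweeping_possible \<Omega> I C \<and> acyclic (dependency_graph \<Omega> I C)"
proof -
  have simplex: "2 simplex C i" if "i \<in> {1..I}" for i
    using assms(1) that unfolding conforming_triangulation_def by blast
  have disjoint: "interior (C i) \<inter> interior (C j) = {}"
    if "i \<in> {1..I}" "j \<in> {1..I}" "i \<noteq> j" for i j
    using assms(1) that unfolding conforming_triangulation_def by blast
  let ?R = "{(j, i). j \<in> {1..I} \<and> i \<in> {1..I} \<and> j \<noteq> i
    \<and> precedes \<Omega> (interior (C j)) (interior (C i))}"
  have "acyclic ?R"
  proof (rule acyclic_precedes_plane)
    show "bounded (interior (C i))" if "i \<in> {1..I}" for i
      using compact_simplex[OF simplex[OF that]]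
      by (meson bounded_interior compact_imp_bounded)
  qed (use assms(2) simplex disjoint in \<open>auto intro: convex_interior convex_simplex\<close>)
  moreover have "dependency_graph \<Omega> I C \<subseteq> ?R"
  proof clarify
    fix j i
    assume "(j, i) \<in> dependency_graph \<Omega> I C"
    then obtain e n where ij: "j \<in> {1..I}" "i \<in> {1..I}" "j \<noteq> i"
      and e: "e edge_of C i" "e edge_of C j" and n: "inward_normal (C i) e n" "n \<bullet> \<Omega> > 0"
      by (auto simp: dependency_graph_def depends_on_def)
    then show "j \<in> {1..I} \<and> i \<in> {1..I} \<and> j \<noteq> i
        \<and> precedes \<Omega> (interior (C j)) (interior (C i))"
      using precedes_interior_across_edge[OF _ _ _ _ _ e n] simplex disjoint
        interior_triangle_nonempty convex_simplex by metis
  qed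
  ultimately have acyc: "acyclic (dependency_graph \<Omega> I C)"
    by (rule acyclic_subset)
  obtain \<sigma> where \<sigma>: "distinct \<sigma>" "set \<sigma> = {1..I}"
    and order: "\<And>p q. p < length \<sigma> \<Longrightarrow> q < length \<sigma>
      \<Longrightarrow> (\<sigma> ! q, \<sigma> ! p) \<in> dependency_graph \<Omega> I C \<Longrightarrow> q < p"
  proof (rule acyclic_imp_topological_order[OF _ acyc])
    show "dependency_graph \<Omega> I C \<subseteq> {1..I} \<times> {1..I}"
      by (auto simp: dependency_graph_def)
  qed auto
  have "sweeping_possible \<Omega> I C"
    unfolding sweeping_possible_def
  proof (intro exI[of _ \<sigma>] conjI allI impI)
    fix p q
    assume pq: "p < length \<sigma>" "q < length \<sigma>" and dep: "depends_on \<Omega> C (\<sigma> ! p) (\<sigma> ! q)"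
    have "\<sigma> ! p \<in> {1..I}" "\<sigma> ! q \<in> {1..I}"
      using pq \<sigma>(2) nth_mem by blast+
    then show "q < p"
      using order pq dep by (simp add: dependency_graph_def)
  qed (use \<sigma> in auto)
  then show ?thesis
    using acyc by simp
qed

end
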